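(* Let $(X_1,d_1),\dots,(X_N,d_N)$ be metric spaces whose metrics $d_i$ take values in $[0,1]$, and let $a_1,\dots,a_N$ be real numbers with $a_i\ge 1$ for all $i$. For $\mathbf{x}=(x_1,\dots,x_N),\mathbf{y}=(y_1,\dots,y_N)\in X_1\times\cdots\times X_N$ define $$d_{a_1,\dots,a_N}(\mathbf{x},\mathbf{y}) := 1-\prod_{i=1}^N\left(1-d_i(x_i,y_i)\right)^{a_i}.$$ Then $d_{a_1,\dots,a_N}$ is a metric on $X_1\times\cdots\times X_N$ taking values in $[0,1]$. *)

theory Defs
  imports "HOL-Analysis.Analysis"
begin

text \<open>The library locale \<^locale>\<open>Metric_space\<close> demands non-negativity and symmetry on the
  whole type, not only on the carrier. Outside the product carrier the formula below is
  meaningless (there \<open>d i\<close> may exceed \<open>1\<close>), so the distance is set to \<open>0\<close> there, as in the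
  library's \<^const>\<open>Metric_space.fdist\<close>.\<close>

definition power_prod_dist ::
  "nat \<Rightarrow> (nat \<Rightarrow> 'a set) \<Rightarrow> (nat \<Rightarrow> 'a \<Rightarrow> 'a \<Rightarrow> real) \<Rightarrow> (nat \<Rightarrow> real)
    \<Rightarrow> (nat \<Rightarrow> 'a) \<Rightarrow> (nat \<Rightarrow> 'a) \<Rightarrow> real"
  where "power_prod_dist N X d a x y =
    (if x \<in> (\<Pi>\<^sub>E i\<in>{1..N}. X i) \<and> y \<in> (\<Pi>\<^sub>E i\<in>{1..N}. X i)
     then 1 - (\<Prod>i=1..N. (1 - d i (x i) (y i)) powr a i)
     else 0)"

end

theory Submission
  imports Defs
begin

text \<open>Passing to the similarities \<open>1 - d\<close>, the triangle inequality becomes \<open>u + v \<le> 1 + w\<close> for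
  numbers in \<open>[0,1]\<close>. This relation is preserved by \<open>t \<mapsto> t powr a\<close> for \<open>a \<ge> 1\<close>, by convexity,
  and by taking componentwise products.\<close>

text \<open>Since \<open>u + v = s + t\<close>, the points \<open>u\<close> and \<open>v\<close> are
  mirror images in \<open>{s..t}\<close>: they are convex combinations of \<open>s\<close> and
  \<open>t\<close> with swapped weights. In the sum of the two convexity bounds the weights of
  \<open>f s\<close> and of \<open>f t\<close> each add up to 1.\<close>

lemma convex_on_sum_le_extremes:
  fixes f :: "real \<Rightarrow> real"
  assumes f: "convex_on {s..t} f" and u: "s \<le> u" "u \<le> t" and v: "u + v = s + t"
  shows "f u + f v \<le> f s + f t"
proof (cases "s = t")
  case True
  then show ?thesis using u v by auto
next
  case False
  then have st: "s < t" using u by simp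
  define l where "l = (u - s) / (t - s)"
  have l: "0 \<le> l" "l \<le> 1" using u st by (auto simp: l_def field_simps)
  have "l * (t - s) = u - s" using st by (simp add: l_def)
  \<comment> \<open>The coefficient \<open>1 - (1 - l)\<close> stays unsimplified so that
    \<open>v\<close> has the shape of \<open>convex_onD\<close> at weight
    \<open>1 - l\<close>.\<close>
  then have ueq: "u = (1 - l) * s + l * t" and veq: "v = (1 - (1 - l)) * s + (1 - l) * t"
    using v by (auto simp: algebra_simps)
  have "f u \<le> (1 - l) * f s + l * f t"
    using convex_onD[OF f, of l s t] l st by (simp add: ueq)
  moreover have "f v \<le> (1 - (1 - l)) * f s + (1 - l) * f t"
    using convex_onD[OF f, of "1 - l" s t] l st by (simp only: veq) simp
  ultimately show ?thesis by (simp add: algebra_simps)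
qed

lemma powr_similarity_triangle:
  fixes u v w a :: real
  assumes u: "u \<in> {0..1}" and v: "v \<in> {0..1}" and w: "0 \<le> w" and a: "1 \<le> a"
    and tri: "u + v \<le> 1 + w"
  shows "u powr a + v powr a \<le> 1 + w powr a"
proof (cases "u + v \<le> 1")
  case True
  have "t powr a \<le> t" if "t \<in> {0..1}" for t :: real
    using that a powr_mono'[of 1 a t] by auto
  from this[OF u] this[OF v] True show ?thesis
    using powr_ge_zero[of w a] by linarith
next
  case False
  \<comment> \<open>The pair \<open>u + v - 1\<close>, \<open>1\<close> has the same sum as
    \<open>u\<close>, \<open>v\<close> and encloses both. Its lower end is the least
    \<open>w\<close> that \<open>tri\<close> allows, so monotonicity then covers every other
    \<open>w\<close>.\<close>
  have "convex_on {u + v - 1..1} (\<lambda>t. t powr a)"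
    by (rule convex_on_subset[OF powr_convex[OF a]]) (use False in auto)
  from convex_on_sum_le_extremes[OF this, of u v]
  have "u powr a + v powr a \<le> (u + v - 1) powr a + 1" using u v by auto
  moreover have "(u + v - 1) powr a \<le> w powr a"
    by (rule powr_mono2) (use False tri a in auto)
  ultimately show ?thesis by linarith
qed

text \<open>If one of the two sums is at most 1, bounding the factors of the other triple by 1
  suffices. Otherwise \<open>w\<close> and \<open>w'\<close> can be replaced by their least
  admissible values, both positive.\<close>

lemma mult_similarity_triangle:
  fixes u v w u' v' w' :: real
  assumes "u \<in> {0..1}" "v \<in> {0..1}" "0 \<le> w" "u + v \<le> 1 + w"
    and "u' \<in> {0..1}" "v' \<in> {0..1}" "0 \<le> w'" "u' + v' \<le> 1 + w'"
  shows "u * u' + v * v' \<le> 1 + w * w'"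
proof -
  have ww: "0 \<le> w * w'" using assms by simp
  consider "u + v \<le> 1" | "u' + v' \<le> 1" | "u + v > 1" "u' + v' > 1" by linarith
  then show ?thesis
  proof cases
    case 1
    have "u * u' \<le> u" "v * v' \<le> v" using assms by (auto intro: mult_left_le)
    then show ?thesis using 1 ww by linarith
  next
    case 2
    have "u * u' \<le> u'" "v * v' \<le> v'" using assms by (auto intro: mult_left_le_one_le)
    then show ?thesis using 2 ww by linarith
  next
    case 3
    have "(u + v - 1) * (u' + v' - 1) \<le> w * w'"
      by (rule mult_mono) (use 3 assms in auto)
    \<comment> \<open>The slack in this extremal case is a sum of products of nonnegative
      factors.\<close>
    moreover have "1 + (u + v - 1) * (u' + v' - 1) - (u * u' + v * v')
        = (1 - u) * (1 - v') + (1 - v) * (1 - u')"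
      by (simp add: algebra_simps)
    moreover have "0 \<le> (1 - u) * (1 - v') + (1 - v) * (1 - u')" using assms by auto
    ultimately show ?thesis by linarith
  qed
qed

lemma prod_in_unit_interval:
  fixes f :: "'i \<Rightarrow> real"
  assumes "\<And>i. i \<in> I \<Longrightarrow> f i \<in> {0..1}"
  shows "prod f I \<in> {0..1}"
  using assms by (auto intro: prod_nonneg prod_le_1)

lemma prod_similarity_triangle:
  fixes u v w :: "'i \<Rightarrow> real"
  assumes "finite I"
    and "\<And>i. i \<in> I \<Longrightarrow> u i \<in> {0..1}" "\<And>i. i \<in> I \<Longrightarrow> v i \<in> {0..1}" "\<And>i. i \<in> I \<Longrightarrow> 0 \<le> w i"
    and "\<And>i. i \<in> I \<Longrightarrow> u i + v i \<le> 1 + w i"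
  shows "prod u I + prod v I \<le> 1 + prod w I"
  using assms
proof (induction I rule: finite_induct)
  case empty
  then show ?case by simp
next
  case (insert i I)
  \<comment> \<open>\<open>atLeastAtMost_iff\<close> is removed from the simpset so that membership
    goals keep the form in which \<open>prod_in_unit_interval\<close> applies.\<close>
  have "u i * prod u I + v i * prod v I \<le> 1 + w i * prod w I"
    by (rule mult_similarity_triangle)
      (use insert.prems in \<open>auto intro!: insert.IH prod_in_unit_interval prod_nonneg
         simp del: atLeastAtMost_iff\<close>)
  then show ?case using insert.hyps by simp
qed

text \<open>Each factor bounds the whole product from above, because the product of the remaining
  factors is at most 1.\<close>

lemma prod_eq_1_unit_interval:
  fixes f :: "'i \<Rightarrow> real"
  assumes I: "finite I" and f: "\<And>i. i \<in> I \<Longrightarrow> f i \<in> {0..1}"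
  shows "prod f I = 1 \<longleftrightarrow> (\<forall>i\<in>I. f i = 1)"
proof
  assume eq: "prod f I = 1"
  show "\<forall>i\<in>I. f i = 1"
  proof
    fix i assume i: "i \<in> I"
    have "prod f I = f i * prod f (I - {i})" using I i by (rule prod.remove)
    also have "\<dots> \<le> f i"
      using prod_in_unit_interval[of "I - {i}" f] f i by (auto intro!: mult_left_le)
    finally show "f i = 1" using eq f[OF i] by simp
  qed
qed simp

theorem theorem2:
  fixes N :: nat
    and X :: "nat \<Rightarrow> 'a set"
    and d :: "nat \<Rightarrow> 'a \<Rightarrow> 'a \<Rightarrow> real"
    and a :: "nat \<Rightarrow> real"
  assumes "\<And>i. i \<in> {1..N} \<Longrightarrow> Metric_space (X i) (d i)"
    and "\<And>i x y. i \<in> {1..N} \<Longrightarrow> x \<in> X i \<Longrightarrow> y \<in> X i \<Longrightarrow> d i x y \<in> {0..1}"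
    and "\<And>i. i \<in> {1..N} \<Longrightarrow> a i \<ge> 1"
  shows "Metric_space (\<Pi>\<^sub>E i\<in>{1..N}. X i) (power_prod_dist N X d a) \<and>
    (\<forall>x\<in>(\<Pi>\<^sub>E i\<in>{1..N}. X i). \<forall>y\<in>(\<Pi>\<^sub>E i\<in>{1..N}. X i).
       power_prod_dist N X d a x y \<in> {0..1})"
proof -
  define P where "P = (\<Pi>\<^sub>E i\<in>{1..N}. X i)"
  define D where "D = power_prod_dist N X d a"
  define s where "s x y i = (1 - d i (x i) (y i)) powr a i" for x y i
  have D_in: "D x y = 1 - prod (s x y) {1..N}" if "x \<in> P" "y \<in> P" for x y
    using that by (simp add: D_def power_prod_dist_def P_def s_def)
  have D_out: "D x y = 0" if "\<not> (x \<in> P \<and> y \<in> P)" for x y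
    using that by (auto simp: D_def power_prod_dist_def P_def)
  have mem: "x i \<in> X i" if "x \<in> P" "i \<in> {1..N}" for x i
    using that by (auto simp: P_def)
  have base: "1 - d i (x i) (y i) \<in> {0..1}" if "x \<in> P" "y \<in> P" "i \<in> {1..N}" for x y i
    using assms(2)[OF that(3) mem[OF that(1,3)] mem[OF that(2,3)]] by simp
  have s_unit: "s x y i \<in> {0..1}" if "x \<in> P" "y \<in> P" "i \<in> {1..N}" for x y i
    using base[OF that] assms(3)[OF that(3)] by (auto simp: s_def intro!: powr_le1)
  have s_1: "s x y i = 1 \<longleftrightarrow> x i = y i" if xy: "x \<in> P" "y \<in> P" and i: "i \<in> {1..N}" for x y i
  proof -
    \<comment> \<open>Strict monotonicity, from \<open>a i > 0\<close>: a positive distance keeps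
      the similarity strictly below 1 after the power is taken.\<close>
    have "t powr a i < 1" if "0 \<le> t" "t < 1" for t :: real
      using powr_less_mono2[of "a i" t 1] that assms(3)[OF i] by simp
    from this[of "1 - d i (x i) (y i)"] have "s x y i = 1 \<longleftrightarrow> 1 - d i (x i) (y i) = 1"
      using base[OF that] by (force simp: s_def order_less_le)
    also have "\<dots> \<longleftrightarrow> x i = y i"
      using Metric_space.zero[OF assms(1)[OF i] mem[OF xy(1) i] mem[OF xy(2) i]] by simp
    finally show ?thesis .
  qed
  have D_unit: "D x y \<in> {0..1}" if "x \<in> P" "y \<in> P" for x y
    using prod_in_unit_interval[of "{1..N}" "s x y"] s_unit[OF that] D_in[OF that] by auto
  have "Metric_space P D"
  proof
    fix x y
    \<comment> \<open>Here \<open>x\<close> and \<open>y\<close> range over the whole type; outside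
      \<open>P\<close> the default value 0 settles this goal and symmetry.\<close>
    show "0 \<le> D x y" using D_unit[of x y] D_out[of x y] by force
    have "s x y i = s y x i" if "i \<in> {1..N}" for i
      using Metric_space.commute[OF assms(1)[OF that]] by (simp add: s_def)
    then have "prod (s x y) {1..N} = prod (s y x) {1..N}" by (rule prod.cong[OF refl])
    then show "D x y = D y x" using D_in D_out by metis
  next
    fix x y assume xy: "x \<in> P" "y \<in> P"
    have "D x y = 0 \<longleftrightarrow> prod (s x y) {1..N} = 1" using D_in[OF xy] by auto
    also have "\<dots> \<longleftrightarrow> (\<forall>i\<in>{1..N}. s x y i = 1)"
      by (rule prod_eq_1_unit_interval) (use s_unit[OF xy] in auto)
    also have "\<dots> \<longleftrightarrow> (\<forall>i\<in>{1..N}. x i = y i)" using s_1[OF xy] by auto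
    \<comment> \<open>Elements of \<open>P\<close> are extensional, so they also agree outside
      \<open>{1..N}\<close>.\<close>
    also have "\<dots> \<longleftrightarrow> x = y" using xy unfolding P_def by (auto intro: PiE_ext)
    finally show "D x y = 0 \<longleftrightarrow> x = y" .
  next
    fix x y z assume x: "x \<in> P" and y: "y \<in> P" and z: "z \<in> P"
    have "s x y i + s y z i \<le> 1 + s x z i" if i: "i \<in> {1..N}" for i
      unfolding s_def
    proof (rule powr_similarity_triangle)
      show "1 - d i (x i) (y i) + (1 - d i (y i) (z i)) \<le> 1 + (1 - d i (x i) (z i))"
        using Metric_space.triangle[OF assms(1)[OF i] mem[OF x i] mem[OF y i] mem[OF z i]] by simp
    qed (use base[OF x y i] base[OF y z i] base[OF x z i] assms(3)[OF i] in auto)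
    then have "prod (s x y) {1..N} + prod (s y z) {1..N} \<le> 1 + prod (s x z) {1..N}"
      by (intro prod_similarity_triangle)
        (use s_unit[OF x y] s_unit[OF y z] s_unit[OF x z] in auto)
    then show "D x z \<le> D x y + D y z" by (simp add: D_in x y z)
  qed
  then show ?thesis using D_unit by (auto simp: P_def D_def)
qed

end
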